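(* Upgradable caching has a deterministic $(d+k)$-competitive online algorithm, where $d$ is the number of upgradable hardware components and $k$ is the maximum number of files that can be held in the cache.
   Context: Upgradable caching: a request sequence $r_1,r_2,\dots$ of items (files) is revealed online. The hardware configuration is a vector $y\in\mathbb R_+^d$, $y_i$ being the amount spent so far on component $i$; initially $y=\mathbf 0$ and the cache is empty. A predicate $\mathrm{cachable}_t(Q,y)$ (for sets $Q$ of items and configurations $y$) is given, which is non-decreasing in $y$ (upgrading never makes a cachable set uncachable) and non-increasing in $Q$ (every subset of a cachable set is cachable); an eviction cost function $\mathrm{cost}(r,y)\ge0$ is given which is non-increasing in $y$. In response to request $r_t$, the algorithm may increase coordinates of $y$; then $r_t$ is brought into the cache if not present; then the algorithm evicts items until the set $Q$ of items in cache satisfies $\mathrm{cachable}_t(Q,y)$, paying $\mathrm{cost}(r_s,y)$ (at the current configuration $y$) for each evicted item $r_s$. The algorithm's total cost is the sum of its eviction costs plus $\sum_i y_i$ for its final configuration $y$. An online algorithm is $\rho$-competitive if its total cost is at most $\rho$ times the minimum total cost achievable by any (offline) strategy on the same request sequence.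
   Formalization: Added: the sets of configurations where a given Q is cachable, or where an eviction cost is at most c, are closed (otherwise the minimum need not exist and no ratio holds); k counts files in the cache at any moment, including the just-requested one before evictions. *)

theory Defs
  imports "HOL-Analysis.Analysis"
begin

text \<open>Elements of \<open>\<real>\<^sub>+\<^sup>d\<close> are functions on \<open>nat\<close> vanishing from index \<open>d\<close> on, so that
  \<open>d = 0\<close> (no upgradable component) is included. Configurations are compared by the pointwise order
  on functions, and \<open>closed\<close> below refers to the product topology, which on \<open>configs d\<close> is
  the Euclidean one.\<close>

type_synonym config = "nat \<Rightarrow> real"

definition configs :: "nat \<Rightarrow> config set" where
  "configs d = {y. (\<forall>i<d. 0 \<le> y i) \<and> (\<forall>i\<ge>d. y i = 0)}"

text \<open>The last conjunct of each of the next two definitions is closure under limits. Without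
  it optimal offline costs need not be attained and no bound on the ratio can hold: if
  the requested item is cachable exactly when \<open>y\<^sub>1 > 0\<close> and has eviction cost 1, the offline cost can
  be made arbitrarily small, whereas an online algorithm commits to a fixed positive amount.\<close>

definition cachable_pred :: "nat \<Rightarrow> ('a set \<Rightarrow> config \<Rightarrow> bool) \<Rightarrow> bool" where
  "cachable_pred d P \<longleftrightarrow>
     (\<forall>Q. \<forall>y\<in>configs d. \<forall>z\<in>configs d. y \<le> z \<longrightarrow> P Q y \<longrightarrow> P Q z) \<and>
     (\<forall>Q Q'. \<forall>y\<in>configs d. Q' \<subseteq> Q \<longrightarrow> P Q y \<longrightarrow> P Q' y) \<and>
     (\<forall>Q. closed {y \<in> configs d. P Q y})"

definition eviction_cost :: "nat \<Rightarrow> ('a \<Rightarrow> config \<Rightarrow> real) \<Rightarrow> bool" where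
  "eviction_cost d cost \<longleftrightarrow>
     (\<forall>q. \<forall>y\<in>configs d. 0 \<le> cost q y) \<and>
     (\<forall>q. \<forall>y\<in>configs d. \<forall>z\<in>configs d. y \<le> z \<longrightarrow> cost q z \<le> cost q y) \<and>
     (\<forall>q c. closed {y \<in> configs d. cost q y \<le> c})"

text \<open>Requests are numbered from 0. The response to request \<open>t\<close> is the configuration after
  upgrading together with the set of items evicted, possibly including the item just requested.\<close>

type_synonym 'a strategy = "nat \<Rightarrow> config \<times> 'a set"

text \<open>Configuration and cache after the first \<open>n\<close> requests have been served.\<close>

fun conf :: "'a strategy \<Rightarrow> nat \<Rightarrow> config" where
  "conf S 0 = (\<lambda>_. 0)"
| "conf S (Suc t) = fst (S t)"

fun cache :: "(nat \<Rightarrow> 'a) \<Rightarrow> 'a strategy \<Rightarrow> nat \<Rightarrow> 'a set" where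
  "cache r S 0 = {}"
| "cache r S (Suc t) = insert (r t) (cache r S t) - snd (S t)"

definition valid ::
  "nat \<Rightarrow> (nat \<Rightarrow> 'a set \<Rightarrow> config \<Rightarrow> bool) \<Rightarrow> (nat \<Rightarrow> 'a) \<Rightarrow> nat \<Rightarrow> 'a strategy \<Rightarrow> bool" where
  "valid d cachable r n S \<longleftrightarrow>
     (\<forall>t<n. conf S (Suc t) \<in> configs d \<and> conf S t \<le> conf S (Suc t) \<and>
        snd (S t) \<subseteq> insert (r t) (cache r S t) \<and>
        cachable t (cache r S (Suc t)) (conf S (Suc t)))"

definition total_cost ::
  "nat \<Rightarrow> ('a \<Rightarrow> config \<Rightarrow> real) \<Rightarrow> nat \<Rightarrow> 'a strategy \<Rightarrow> real" where
  "total_cost d cost n S =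
     (\<Sum>t<n. \<Sum>q\<in>snd (S t). cost q (conf S (Suc t))) + (\<Sum>i<d. conf S n i)"

definition opt_cost ::
  "nat \<Rightarrow> ('a \<Rightarrow> config \<Rightarrow> real) \<Rightarrow> (nat \<Rightarrow> 'a set \<Rightarrow> config \<Rightarrow> bool) \<Rightarrow> (nat \<Rightarrow> 'a) \<Rightarrow> nat \<Rightarrow> real" where
  "opt_cost d cost cachable r n = Inf {total_cost d cost n S | S. valid d cachable r n S}"

text \<open>A deterministic online algorithm maps the history revealed so far, namely the requests and
  cachability predicates up to the current time, to its response.\<close>

type_synonym 'a online_alg = "('a \<times> ('a set \<Rightarrow> config \<Rightarrow> bool)) list \<Rightarrow> config \<times> 'a set"

definition run ::
  "'a online_alg \<Rightarrow> (nat \<Rightarrow> 'a set \<Rightarrow> config \<Rightarrow> bool) \<Rightarrow> (nat \<Rightarrow> 'a) \<Rightarrow> 'a strategy" where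
  "run alg cachable r t = alg (map (\<lambda>s. (r s, cachable s)) [0..<Suc t])"

definition competitive ::
  "nat \<Rightarrow> ('a \<Rightarrow> config \<Rightarrow> real) \<Rightarrow> (nat \<Rightarrow> 'a set \<Rightarrow> config \<Rightarrow> bool) \<Rightarrow> 'a online_alg \<Rightarrow> real \<Rightarrow> bool" where
  "competitive d cost cachable alg \<rho> \<longleftrightarrow>
     (\<forall>r n. (\<exists>S. valid d cachable r n S) \<longrightarrow>
        valid d cachable r n (run alg cachable r) \<and>
        total_cost d cost n (run alg cachable r) \<le> \<rho> * opt_cost d cost cachable r n)"

text \<open>The possible numbers of files in the cache. Within a step the cache is largest when the
  requested item has just been brought in and nothing has been evicted yet.\<close>

definition occupancies :: "nat \<Rightarrow> (nat \<Rightarrow> 'a set \<Rightarrow> config \<Rightarrow> bool) \<Rightarrow> nat set" where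
  "occupancies d cachable =
     {card (insert (r t) (cache r S t)) | r S t. valid d cachable r (Suc t) S}"

end

theory Submission
  imports Defs
begin

text \<open>The algorithm keeps all \<open>d\<close> components at a common level \<open>\<tau>\<close>, and an item \<open>q\<close> in its cache
  carries the credit \<open>\<tau> - a q\<close>, where \<open>a q\<close> is the level at the last request of \<open>q\<close>. While the cache
  content is not cachable, \<open>\<tau>\<close> is raised to the least level at which the content becomes cachable or
  the credit of some item pays for its eviction, and in the latter case that item is evicted.
  Let \<open>T\<close> be the final level. Evictions are paid by credits, and at most \<open>k\<close> credits grow with the
  level, so the algorithm pays at most \<open>(d + k) T\<close>. On the other hand every offline strategy pays at
  least \<open>T\<close>: whenever the level rises, either some component of the offline configuration is above
  the level, or some item in the algorithm's cache has been evicted offline at a cost exceeding its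
  credit. Hence the part of the offline expenditure not yet matched by levels and credits decreases
  at least as fast as the level rises.\<close>

section \<open>Sums of positive parts and credits under a rising level\<close>

lemma sum_residual_mono:
  fixes v :: "'b \<Rightarrow> real"
  assumes "\<tau> \<le> \<sigma>"
  shows "(\<Sum>x\<in>A. max 0 (v x - \<sigma>)) \<le> (\<Sum>x\<in>A. max 0 (v x - \<tau>))"
  using assms by (intro sum_mono) auto

text \<open>The summand at \<open>j\<close> falls by exactly \<open>\<sigma> - \<tau>\<close>,
  because \<open>v j\<close> is still at least \<open>\<sigma>\<close>; the other summands do not
  grow.\<close>

lemma sum_residual_drop:
  fixes v :: "'b \<Rightarrow> real"
  assumes "finite A" "j \<in> A" "\<tau> \<le> \<sigma>" "\<sigma> \<le> v j"
  shows "\<sigma> + (\<Sum>x\<in>A. max 0 (v x - \<sigma>)) \<le> \<tau> + (\<Sum>x\<in>A. max 0 (v x - \<tau>))"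
  using assms sum_residual_mono[of \<tau> \<sigma> v "A - {j}"]
  by (simp add: sum.remove[of A j])

lemma sum_credits_raise:
  fixes a :: "'b \<Rightarrow> real"
  shows "(\<Sum>q\<in>Q. \<sigma> - a q) = (\<Sum>q\<in>Q. \<tau> - a q) + real (card Q) * (\<sigma> - \<tau>)"
  by (simp add: sum_subtractf algebra_simps)

section \<open>Configurations with all components at a common level\<close>

definition level :: "nat \<Rightarrow> real \<Rightarrow> config" where
  "level d \<tau> = (\<lambda>i. if i < d then \<tau> else 0)"

lemma level_in_configs: "0 \<le> \<tau> \<Longrightarrow> level d \<tau> \<in> configs d"
  by (simp add: level_def configs_def)

lemma level_mono: "\<sigma> \<le> \<tau> \<Longrightarrow> level d \<sigma> \<le> level d \<tau>"
  by (simp add: level_def le_fun_def)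

lemma le_level:
  assumes "y \<in> configs d" "\<And>i. i < d \<Longrightarrow> y i \<le> \<tau>"
  shows "y \<le> level d \<tau>"
  using assms by (auto simp: level_def le_fun_def configs_def)

lemma continuous_on_level: "continuous_on UNIV (level d)"
proof (rule continuous_on_coordinatewise_then_product)
  show "continuous_on UNIV (\<lambda>\<tau>. level d \<tau> i)" for i
    by (cases "i < d") (simp_all add: level_def)
qed

text \<open>The bound \<open>\<tau> \<le> \<sigma>\<close> with \<open>0 \<le> \<tau>\<close> keeps
  the levels nonnegative, so that \<open>level d \<sigma>\<close> stays in \<open>configs d\<close>,
  to which the closedness hypothesis is restricted.\<close>

lemma closed_level_vimage:
  assumes "closed {y \<in> configs d. R y}" "0 \<le> \<tau>"
  shows "closed {\<sigma>. \<tau> \<le> \<sigma> \<and> R (level d \<sigma>)}"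
proof -
  have "{\<sigma>. \<tau> \<le> \<sigma> \<and> R (level d \<sigma>)} = {\<tau>..} \<inter> level d -` {y \<in> configs d. R y}"
    using assms(2) by (auto intro: level_in_configs)
  moreover have "closed (level d -` {y \<in> configs d. R y})"
    by (rule closed_vimage[OF assms(1) continuous_on_level])
  ultimately show ?thesis by auto
qed

lemma cachable_pred_mono:
  assumes "cachable_pred d P" "y \<in> configs d" "z \<in> configs d" "y \<le> z" "Q' \<subseteq> Q" "P Q y"
  shows "P Q' z"
  using assms unfolding cachable_pred_def by blast

section \<open>The residual of offline strategies\<close>

locale upgradable_caching =
  fixes d :: nat and cost :: "'a \<Rightarrow> config \<Rightarrow> real"
  assumes eviction_cost: "eviction_cost d cost"
begin

lemma cost_nonneg: "y \<in> configs d \<Longrightarrow> 0 \<le> cost q y"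
  using eviction_cost by (auto simp: eviction_cost_def)

lemma cost_antimono: "y \<in> configs d \<Longrightarrow> z \<in> configs d \<Longrightarrow> y \<le> z \<Longrightarrow> cost q z \<le> cost q y"
  using eviction_cost by (auto simp: eviction_cost_def)

text \<open>The expenditure of an offline strategy with final configuration \<open>y\<close> and cache \<open>C\<close> that is not
  matched by the level \<open>\<tau>\<close> and the credits of the items in \<open>Q\<close>.\<close>

definition residual :: "'a set \<Rightarrow> config \<Rightarrow> ('a \<Rightarrow> real) \<Rightarrow> real \<Rightarrow> 'a set \<Rightarrow> real" where
  "residual C y a \<tau> Q =
     (\<Sum>i<d. max 0 (y i - \<tau>)) + (\<Sum>q\<in>Q - C. max 0 (cost q y + a q - \<tau>))"

lemma residual_nonneg: "0 \<le> residual C y a \<tau> Q"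
  unfolding residual_def by (intro add_nonneg_nonneg sum_nonneg) auto

lemma residual_mono_items: "finite Q \<Longrightarrow> Q' \<subseteq> Q \<Longrightarrow> residual C y a \<tau> Q' \<le> residual C y a \<tau> Q"
  unfolding residual_def by (intro add_left_mono sum_mono2) auto

text \<open>For \<open>\<tau> < \<sigma>\<close> some \<open>y i\<close>, or some
  \<open>cost q y + a q\<close> with \<open>q \<in> Q - C\<close>, reaches \<open>\<sigma>\<close>,
  and its term alone yields the drop. Otherwise the level could stop below \<open>\<sigma>\<close>
  at a value dominating \<open>y\<close>: there \<open>Q\<close> is cachable if
  \<open>Q \<subseteq> C\<close>, and any item of \<open>Q - C\<close> is affordable, against
  \<open>unsat\<close>.\<close>

lemma residual_drop:
  assumes P: "cachable_pred d P" and fin: "finite Q" and \<tau>: "0 \<le> \<tau>" "\<tau> \<le> \<sigma>"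
    and unsat: "\<And>\<rho>. \<tau> \<le> \<rho> \<Longrightarrow> \<rho> < \<sigma> \<Longrightarrow>
          \<not> P Q (level d \<rho>) \<and> (\<forall>q\<in>Q. \<rho> - a q < cost q (level d \<rho>))"
    and y: "y \<in> configs d" and C: "P C y"
  shows "\<sigma> + residual C y a \<sigma> Q \<le> \<tau> + residual C y a \<tau> Q"
proof (cases "\<sigma> = \<tau>")
  case False
  have "(\<exists>i\<in>{..<d}. \<sigma> \<le> y i) \<or> (\<exists>q\<in>Q - C. \<sigma> \<le> cost q y + a q)"
  proof (rule ccontr)
    assume neg: "\<not> ?thesis"
    \<comment> \<open>Including \<open>\<tau>\<close> makes \<open>V\<close> nonempty in all cases
      and places its maximum in the range covered by \<open>unsat\<close>.\<close>
    define V where "V = insert \<tau> (y ` {..<d} \<union> (\<lambda>q. cost q y + a q) ` (Q - C))"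
    define \<rho> where "\<rho> = Max V"
    have V: "finite V" "V \<noteq> {}"
      using fin by (auto simp: V_def)
    have \<rho>_ge: "v \<le> \<rho>" if "v \<in> V" for v
      using V that by (simp add: \<rho>_def)
    have "\<tau> \<le> \<rho>" and y_le: "\<And>i. i < d \<Longrightarrow> y i \<le> \<rho>"
      and c_le: "\<And>q. q \<in> Q - C \<Longrightarrow> cost q y + a q \<le> \<rho>"
      by (rule \<rho>_ge, simp add: V_def)+
    have "\<rho> < \<sigma>"
      unfolding \<rho>_def using V neg False \<tau> by (subst Max_less_iff) (auto simp: V_def not_le)
    have lev: "level d \<rho> \<in> configs d" "y \<le> level d \<rho>"
      using \<tau> \<open>\<tau> \<le> \<rho>\<close> y_le y by (auto intro: level_in_configs le_level)
    have "\<not> Q \<subseteq> C"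
      using unsat[OF \<open>\<tau> \<le> \<rho>\<close> \<open>\<rho> < \<sigma>\<close>] cachable_pred_mono[OF P y lev _ C] by blast
    then obtain q where q: "q \<in> Q - C" by blast
    then have "\<rho> - a q < cost q (level d \<rho>)"
      using unsat[OF \<open>\<tau> \<le> \<rho>\<close> \<open>\<rho> < \<sigma>\<close>] by blast
    then show False
      using cost_antimono[OF y lev, of q] c_le[OF q] by linarith
  qed
  then show ?thesis
  proof
    assume "\<exists>i\<in>{..<d}. \<sigma> \<le> y i"
    then obtain i where "i \<in> {..<d}" "\<sigma> \<le> y i" by blast
    from sum_residual_drop[of "{..<d}" i \<tau> \<sigma> y, OF finite_lessThan this(1) \<tau>(2) this(2)] show ?thesis
      using sum_residual_mono[OF \<tau>(2), of "\<lambda>q. cost q y + a q" "Q - C"]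
      unfolding residual_def by linarith
  next
    assume "\<exists>q\<in>Q - C. \<sigma> \<le> cost q y + a q"
    then obtain q where "q \<in> Q - C" "\<sigma> \<le> cost q y + a q" by blast
    from sum_residual_drop[of "Q - C" q \<tau> \<sigma> "\<lambda>q. cost q y + a q", OF _ this(1) \<tau>(2) this(2)]
    show ?thesis
      using sum_residual_mono[OF \<tau>(2), of y "{..<d}"] fin
      unfolding residual_def by simp
  qed
qed simp

section \<open>Least sufficient levels and sound responses\<close>

text \<open>Closedness of cost sublevel sets is given for a fixed threshold only, whereas here the
  threshold moves with \<open>\<sigma>\<close>. The condition is therefore split over all constants
  \<open>c\<close>: either the cost is at most \<open>c\<close>, or \<open>\<sigma> - b\<close> is
  at least \<open>c\<close>.\<close>

lemma closed_affordable_levels: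
  assumes "0 \<le> \<tau>"
  shows "closed {\<sigma>. \<tau> \<le> \<sigma> \<and> cost q (level d \<sigma>) \<le> \<sigma> - b}"
proof -
  have "{\<sigma>. \<tau> \<le> \<sigma> \<and> cost q (level d \<sigma>) \<le> \<sigma> - b} =
      {\<tau>..} \<inter> (\<Inter>c. {\<sigma>. \<tau> \<le> \<sigma> \<and> cost q (level d \<sigma>) \<le> c} \<union> {c + b..})"
    (is "?L = ?R")
  proof
    show "?L \<subseteq> ?R" by auto
    show "?R \<subseteq> ?L"
    proof
      fix \<sigma> assume \<sigma>: "\<sigma> \<in> ?R"
      have "cost q (level d \<sigma>) \<le> \<sigma> - b"
      proof (rule dense_ge)
        fix c assume "\<sigma> - b < c"
        with \<sigma> show "cost q (level d \<sigma>) \<le> c"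
          by (auto dest!: spec[of _ c])
      qed
      with \<sigma> show "\<sigma> \<in> ?L" by auto
    qed
  qed
  moreover have "closed {\<sigma>. \<tau> \<le> \<sigma> \<and> cost q (level d \<sigma>) \<le> c}" for c
    using eviction_cost assms by (intro closed_level_vimage) (auto simp: eviction_cost_def)
  ultimately show ?thesis
    by (simp only:) (intro closed_Int closed_INT ballI closed_Un closed_atLeast)
qed

text \<open>The sufficient levels form a closed set, nonempty and bounded below by
  \<open>\<tau>\<close>, so the infimum belongs to it. Closedness of the union over items uses
  finiteness of \<open>Q\<close>.\<close>

lemma least_sufficient_level:
  assumes P: "cachable_pred d P" and fin: "finite Q" and \<tau>: "0 \<le> \<tau>"
    and feas: "z \<in> configs d" "P {} z"
  obtains \<sigma> where "\<tau> \<le> \<sigma>"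
    and "P Q (level d \<sigma>) \<or> (\<exists>q\<in>Q. cost q (level d \<sigma>) \<le> \<sigma> - a q)"
    and "\<And>\<rho>. \<tau> \<le> \<rho> \<Longrightarrow> \<rho> < \<sigma> \<Longrightarrow>
          \<not> P Q (level d \<rho>) \<and> (\<forall>q\<in>Q. \<rho> - a q < cost q (level d \<rho>))"
proof -
  define G where "G = {\<sigma>. \<tau> \<le> \<sigma> \<and> P Q (level d \<sigma>)} \<union>
    (\<Union>q\<in>Q. {\<sigma>. \<tau> \<le> \<sigma> \<and> cost q (level d \<sigma>) \<le> \<sigma> - a q})"
  have "closed G"
    unfolding G_def using P \<tau> fin
    by (intro closed_Un closed_UN closed_level_vimage ballI closed_affordable_levels)
      (auto simp: cachable_pred_def)
  moreover have "G \<noteq> {}"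
  proof (cases "Q = {}")
    case True
    define \<sigma> where "\<sigma> = Max (insert \<tau> (z ` {..<d}))"
    have "\<tau> \<le> \<sigma>" and "z i \<le> \<sigma>" if "i < d" for i
      unfolding \<sigma>_def using that by (auto intro: Max_ge)
    then have "\<tau> \<le> \<sigma>" "z \<le> level d \<sigma>"
      using feas by (auto intro: le_level simp: \<sigma>_def)
    then have "P Q (level d \<sigma>)"
      using cachable_pred_mono[OF P feas(1) level_in_configs, of \<sigma> "{}" "{}"] \<tau> feas True by auto
    with \<open>\<tau> \<le> \<sigma>\<close> show ?thesis by (auto simp: G_def)
  next
    case False
    then obtain q where q: "q \<in> Q" by blast
    \<comment> \<open>Here the credit of \<open>q\<close> covers its cost at level
      \<open>\<tau>\<close>, and the cost at the higher level is no larger.\<close>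
    define \<sigma> where "\<sigma> = max \<tau> (cost q (level d \<tau>) + a q)"
    have "cost q (level d \<sigma>) \<le> cost q (level d \<tau>)"
      using \<tau> by (intro cost_antimono level_in_configs level_mono) (auto simp: \<sigma>_def)
    then have "\<tau> \<le> \<sigma>" "cost q (level d \<sigma>) \<le> \<sigma> - a q"
      by (auto simp: \<sigma>_def)
    with q show ?thesis by (auto simp: G_def)
  qed
  moreover have bdd: "bdd_below G"
    by (rule bdd_belowI[of _ \<tau>]) (auto simp: G_def)
  ultimately have "Inf G \<in> G"
    by (intro closed_contains_Inf)
  have "\<rho> \<notin> G" if "\<rho> < Inf G" for \<rho>
    using cInf_lower[OF _ bdd] that by force
  then have "\<not> P Q (level d \<rho>) \<and> (\<forall>q\<in>Q. \<rho> - a q < cost q (level d \<rho>))"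
    if "\<tau> \<le> \<rho>" "\<rho> < Inf G" for \<rho>
    using that by (fastforce simp: G_def not_le)
  moreover have "\<tau> \<le> Inf G"
    and "P Q (level d (Inf G)) \<or> (\<exists>q\<in>Q. cost q (level d (Inf G)) \<le> Inf G - a q)"
    using \<open>Inf G \<in> G\<close> unfolding G_def by blast+
  ultimately show thesis
    using that by blast
qed

text \<open>Raising the level from \<open>\<tau>\<close> to \<open>\<tau>'\<close> and shrinking the cache from \<open>Q\<close> to \<open>Q'\<close> is a sound response
  to \<open>P\<close> if credits pay for the evictions and, against every offline strategy, the level rises by at
  most the amount by which the residual falls.\<close>

definition sound_response ::
  "('a set \<Rightarrow> config \<Rightarrow> bool) \<Rightarrow> ('a \<Rightarrow> real) \<Rightarrow> real \<Rightarrow> 'a set \<Rightarrow> real \<Rightarrow> 'a set \<Rightarrow> bool" where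
  "sound_response P a \<tau> Q \<tau>' Q' \<longleftrightarrow>
     \<tau> \<le> \<tau>' \<and> Q' \<subseteq> Q \<and> P Q' (level d \<tau>') \<and>
     (\<Sum>q\<in>Q - Q'. cost q (level d \<tau>')) + (\<Sum>q\<in>Q'. \<tau>' - a q)
       \<le> (\<Sum>q\<in>Q. \<tau> - a q) + real (card Q) * (\<tau>' - \<tau>) \<and>
     (\<forall>C y. y \<in> configs d \<longrightarrow> P C y \<longrightarrow>
        \<tau>' + residual C y a \<tau>' Q' \<le> \<tau> + residual C y a \<tau> Q)"

text \<open>Induction on the cache: after raising to the least sufficient level, either the content
  is cachable or an affordable item is evicted, and the induction hypothesis continues from the
  smaller set at the new level.\<close>

lemma sound_response_exists:
  assumes P: "cachable_pred d P" and fin: "finite Q" and \<tau>: "0 \<le> \<tau>"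
    and feas: "z \<in> configs d" "P {} z"
  shows "\<exists>\<tau>' Q'. sound_response P a \<tau> Q \<tau>' Q'"
  using fin \<tau>
proof (induction Q arbitrary: \<tau> rule: finite_psubset_induct)
  case (psubset Q)
  obtain \<sigma> where \<sigma>: "\<tau> \<le> \<sigma>"
    and sat: "P Q (level d \<sigma>) \<or> (\<exists>q\<in>Q. cost q (level d \<sigma>) \<le> \<sigma> - a q)"
    and least: "\<And>\<rho>. \<tau> \<le> \<rho> \<Longrightarrow> \<rho> < \<sigma> \<Longrightarrow>
          \<not> P Q (level d \<rho>) \<and> (\<forall>q\<in>Q. \<rho> - a q < cost q (level d \<rho>))"
    using least_sufficient_level[OF P psubset.hyps psubset.prems feas, where a = a] by metis
  have drop: "\<sigma> + residual C y a \<sigma> Q \<le> \<tau> + residual C y a \<tau> Q"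
    if "y \<in> configs d" "P C y" for C y
    using residual_drop[OF P psubset.hyps psubset.prems \<sigma> least that] .
  have raise: "(\<Sum>q\<in>Q. \<sigma> - a q) = (\<Sum>q\<in>Q. \<tau> - a q) + real (card Q) * (\<sigma> - \<tau>)"
    by (rule sum_credits_raise)
  show ?case
  proof (cases "P Q (level d \<sigma>)")
    case True
    then have "sound_response P a \<tau> Q \<sigma> Q"
      using \<sigma> drop raise by (simp add: sound_response_def)
    then show ?thesis by blast
  next
    case False
    then obtain q where q: "q \<in> Q" and q_cost: "cost q (level d \<sigma>) \<le> \<sigma> - a q"
      using sat by blast
    have "0 \<le> \<sigma>" using psubset.prems \<sigma> by simp
    then obtain \<tau>' Q' where r: "sound_response P a \<sigma> (Q - {q}) \<tau>' Q'"
      using psubset.IH[of "Q - {q}" \<sigma>] q by blast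
    have le: "\<sigma> \<le> \<tau>'" and sub: "Q' \<subseteq> Q - {q}" and pay:
      "(\<Sum>q\<in>Q - {q} - Q'. cost q (level d \<tau>')) + (\<Sum>q\<in>Q'. \<tau>' - a q)
       \<le> (\<Sum>q\<in>Q - {q}. \<sigma> - a q) + real (card (Q - {q})) * (\<tau>' - \<sigma>)"
      using r by (simp_all add: sound_response_def)
    \<comment> \<open>The credit of \<open>q\<close> covers its cost at level
      \<open>\<sigma>\<close>, but all evictions of one response are charged at the final level
      \<open>\<tau>'\<close>, where the cost can only be lower.\<close>
    have "cost q (level d \<tau>') \<le> cost q (level d \<sigma>)"
      using le \<open>0 \<le> \<sigma>\<close> by (intro cost_antimono level_in_configs level_mono) auto
    moreover have "(\<Sum>q\<in>Q - Q'. cost q (level d \<tau>')) =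
        cost q (level d \<tau>') + (\<Sum>q\<in>Q - {q} - Q'. cost q (level d \<tau>'))"
    proof -
      have "Q - {q} - Q' = Q - Q' - {q}" by blast
      moreover have "q \<in> Q - Q'" using q sub by blast
      ultimately show ?thesis
        using psubset.hyps by (simp add: sum.remove[of "Q - Q'" q])
    qed
    moreover have "(\<Sum>q\<in>Q. \<sigma> - a q) = \<sigma> - a q + (\<Sum>q\<in>Q - {q}. \<sigma> - a q)"
      by (rule sum.remove[OF psubset.hyps q])
    moreover have "real (card (Q - {q})) * (\<tau>' - \<sigma>) \<le> real (card Q) * (\<tau>' - \<sigma>)"
      using le psubset.hyps by (intro mult_right_mono) (auto intro: card_mono)
    moreover have "real (card Q) * (\<tau>' - \<tau>) =
        real (card Q) * (\<tau>' - \<sigma>) + real (card Q) * (\<sigma> - \<tau>)"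
      by (simp add: algebra_simps)
    ultimately have "(\<Sum>q\<in>Q - Q'. cost q (level d \<tau>')) + (\<Sum>q\<in>Q'. \<tau>' - a q)
        \<le> (\<Sum>q\<in>Q. \<tau> - a q) + real (card Q) * (\<tau>' - \<tau>)"
      using pay q_cost raise by linarith
    moreover have "\<tau>' + residual C y a \<tau>' Q' \<le> \<tau> + residual C y a \<tau> Q"
      if "y \<in> configs d" "P C y" for C y
    proof -
      have "\<tau>' + residual C y a \<tau>' Q' \<le> \<sigma> + residual C y a \<sigma> (Q - {q})"
        using r that by (simp add: sound_response_def)
      also have "\<dots> \<le> \<sigma> + residual C y a \<sigma> Q"
        using residual_mono_items[OF psubset.hyps] by auto
      finally show ?thesis using drop[OF that] by linarith
    qed
    ultimately have "sound_response P a \<tau> Q \<tau>' Q'"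
      using r \<sigma> le sub by (auto simp: sound_response_def)
    then show ?thesis by blast
  qed
qed

section \<open>The online algorithm as a fold over the history\<close>

text \<open>A fixed choice depending only on its arguments keeps the algorithm deterministic and
  online. It is arbitrary if no sound response exists.\<close>

definition respond ::
  "('a set \<Rightarrow> config \<Rightarrow> bool) \<Rightarrow> ('a \<Rightarrow> real) \<Rightarrow> real \<Rightarrow> 'a set \<Rightarrow> real \<times> 'a set" where
  "respond P a \<tau> Q = (SOME (\<tau>', Q'). sound_response P a \<tau> Q \<tau>' Q')"

lemma sound_respond:
  assumes "\<exists>\<tau>' Q'. sound_response P a \<tau> Q \<tau>' Q'"
  shows "sound_response P a \<tau> Q (fst (respond P a \<tau> Q)) (snd (respond P a \<tau> Q))"
proof -
  have "\<exists>p. case p of (\<tau>', Q') \<Rightarrow> sound_response P a \<tau> Q \<tau>' Q'"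
    using assms by simp
  then show ?thesis
    unfolding respond_def by (rule someI2_ex) auto
qed

text \<open>The base of the requested item is reset before the response, so this item starts with
  zero credit and forfeits any earlier one.\<close>

fun step ::
  "('a \<Rightarrow> real) \<times> real \<times> 'a set \<Rightarrow> 'a \<times> ('a set \<Rightarrow> config \<Rightarrow> bool) \<Rightarrow> ('a \<Rightarrow> real) \<times> real \<times> 'a set"
  where
  "step (a, \<tau>, Q) (q, P) = (a(q := \<tau>), respond P (a(q := \<tau>)) \<tau> (insert q Q))"

definition state_after ::
  "('a \<times> ('a set \<Rightarrow> config \<Rightarrow> bool)) list \<Rightarrow> ('a \<Rightarrow> real) \<times> real \<times> 'a set" where
  "state_after = foldl step (\<lambda>_. 0, 0, {})"

text \<open>A response names the evicted items, not the remaining cache, so the previous cache is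
  recomputed from \<open>butlast h\<close>.\<close>

definition level_alg :: "'a online_alg" where
  "level_alg h =
     (level d (fst (snd (state_after h))),
      insert (fst (last h)) (snd (snd (state_after (butlast h)))) - snd (snd (state_after h)))"

end

section \<open>The run on a fixed feasible request sequence\<close>

locale upgradable_caching_instance = upgradable_caching d cost
  for d :: nat and cost :: "'a \<Rightarrow> config \<Rightarrow> real" +
  fixes cachable :: "nat \<Rightarrow> 'a set \<Rightarrow> config \<Rightarrow> bool" and r :: "nat \<Rightarrow> 'a" and n :: nat
  assumes cachable: "\<And>t. cachable_pred d (cachable t)"
    and feasible: "\<exists>S. valid d cachable r n S"
begin

definition state :: "nat \<Rightarrow> ('a \<Rightarrow> real) \<times> real \<times> 'a set" where
  "state t = state_after (map (\<lambda>s. (r s, cachable s)) [0..<t])"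

abbreviation base :: "nat \<Rightarrow> 'a \<Rightarrow> real" where "base t \<equiv> fst (state t)"
abbreviation lev :: "nat \<Rightarrow> real" where "lev t \<equiv> fst (snd (state t))"
abbreviation items :: "nat \<Rightarrow> 'a set" where "items t \<equiv> snd (snd (state t))"

abbreviation alg_run :: "'a strategy" where "alg_run \<equiv> run level_alg cachable r"

lemma state_0: "state 0 = (\<lambda>_. 0, 0, {})"
  by (simp add: state_def state_after_def)

lemma state_Suc: "state (Suc t) = step (state t) (r t, cachable t)"
  by (simp add: state_def state_after_def)

lemma base_Suc: "base (Suc t) = (base t)(r t := lev t)"
  by (cases "state t") (simp add: state_Suc)

lemma lev_items_Suc:
  "snd (state (Suc t)) = respond (cachable t) (base (Suc t)) (lev t) (insert (r t) (items t))"
  by (cases "state t") (simp add: state_Suc)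

lemma alg_run_eq:
  "alg_run t = (level d (lev (Suc t)), insert (r t) (items t) - items (Suc t))"
  by (simp add: run_def level_alg_def state_def)

lemma feasible_empty:
  assumes "t < n"
  obtains z where "z \<in> configs d" "cachable t {} z"
proof -
  obtain S where S: "valid d cachable r n S" using feasible by blast
  then have "conf S (Suc t) \<in> configs d" "cachable t (cache r S (Suc t)) (conf S (Suc t))"
    using assms unfolding valid_def by blast+
  then show thesis
    using cachable_pred_mono[OF cachable, of "conf S (Suc t)" "conf S (Suc t)" "{}"] that by blast
qed

text \<open>This identifies the internal state with the actual cache and configuration of the run.
  Feasibility makes the empty set cachable somewhere at each step, which guarantees that the chosen
  response is sound.\<close>

lemma state_invariant:
  "t \<le> n \<Longrightarrow> 0 \<le> lev t \<and> finite (items t) \<and> (\<forall>q. base t q \<le> lev t) \<and>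
    cache r alg_run t = items t \<and> conf alg_run t = level d (lev t) \<and>
    (\<forall>s<t. sound_response (cachable s) (base (Suc s)) (lev s) (insert (r s) (items s))
             (lev (Suc s)) (items (Suc s)))"
proof (induction t)
  case 0
  show ?case by (simp add: state_0 level_def)
next
  case (Suc t)
  then have IH: "0 \<le> lev t" "finite (items t)" "\<And>q. base t q \<le> lev t" "cache r alg_run t = items t"
    "\<forall>s<t. sound_response (cachable s) (base (Suc s)) (lev s) (insert (r s) (items s))
             (lev (Suc s)) (items (Suc s))"
    by auto
  obtain z where "z \<in> configs d" "cachable t {} z"
    using feasible_empty Suc.prems by (metis Suc_le_lessD)
  then have sound: "sound_response (cachable t) (base (Suc t)) (lev t) (insert (r t) (items t))
             (lev (Suc t)) (items (Suc t))"
    unfolding lev_items_Suc using IH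
    by (intro sound_respond sound_response_exists cachable) auto
  then have le: "lev t \<le> lev (Suc t)" and sub: "items (Suc t) \<subseteq> insert (r t) (items t)"
    by (simp_all add: sound_response_def)
  have "base (Suc t) q \<le> lev (Suc t)" for q
    using IH(3)[of q] le by (simp add: base_Suc)
  moreover have "finite (items (Suc t))"
    using sub IH(2) by (simp add: finite_subset)
  moreover have "cache r alg_run (Suc t) = items (Suc t)"
    using sub IH(4) by (auto simp only: cache.simps alg_run_eq snd_conv)
  moreover have "conf alg_run (Suc t) = level d (lev (Suc t))"
    by (simp only: conf.simps alg_run_eq fst_conv)
  moreover have "0 \<le> lev (Suc t)"
    using IH(1) le by simp
  ultimately show ?case
    using IH(5) sound less_Suc_eq by blast
qed

lemma sound_step:
  assumes "t < n"
  shows "sound_response (cachable t) (base (Suc t)) (lev t) (insert (r t) (items t))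
           (lev (Suc t)) (items (Suc t))"
  using state_invariant[of n] assms by blast

lemma valid_alg_run: "valid d cachable r n alg_run"
  unfolding valid_def
proof (intro allI impI)
  fix t assume t: "t < n"
  note inv = state_invariant[of t] state_invariant[of "Suc t"]
  have c: "conf alg_run t = level d (lev t)" "conf alg_run (Suc t) = level d (lev (Suc t))"
    "cache r alg_run t = items t" "cache r alg_run (Suc t) = items (Suc t)"
    "0 \<le> lev (Suc t)"
    using inv t by auto
  show "conf alg_run (Suc t) \<in> configs d \<and> conf alg_run t \<le> conf alg_run (Suc t) \<and>
        snd (alg_run t) \<subseteq> insert (r t) (cache r alg_run t) \<and>
        cachable t (cache r alg_run (Suc t)) (conf alg_run (Suc t))"
    unfolding c using sound_step[OF t] c(5)
    by (auto simp: sound_response_def alg_run_eq intro: level_in_configs level_mono)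
qed

section \<open>Upper bound on the cost of the algorithm\<close>

text \<open>The outstanding credits serve as potential: evictions are paid from them, and at most
  \<open>k\<close> of them grow while the level rises.\<close>

lemma alg_evictions_le:
  assumes k: "\<And>t. t < n \<Longrightarrow> card (insert (r t) (cache r alg_run t)) \<le> k"
  shows "t \<le> n \<Longrightarrow> (\<Sum>s<t. \<Sum>q\<in>snd (alg_run s). cost q (conf alg_run (Suc s)))
           + (\<Sum>q\<in>items t. lev t - base t q) \<le> real k * lev t"
proof (induction t)
  case 0
  show ?case by (simp add: state_0)
next
  case (Suc t)
  have t: "t < n" using Suc.prems by simp
  have inv: "finite (items t)" "\<And>q. base t q \<le> lev t" "cache r alg_run t = items t"
    using state_invariant[of t] t by auto
  have le: "lev t \<le> lev (Suc t)"
    and pay: "(\<Sum>q\<in>insert (r t) (items t) - items (Suc t). cost q (level d (lev (Suc t))))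
        + (\<Sum>q\<in>items (Suc t). lev (Suc t) - base (Suc t) q)
       \<le> (\<Sum>q\<in>insert (r t) (items t). lev t - base (Suc t) q)
         + real (card (insert (r t) (items t))) * (lev (Suc t) - lev t)"
    using sound_step[OF t] by (simp_all add: sound_response_def)
  \<comment> \<open>The requested item contributes zero after its base is reset, and forfeiting its
    old credit only lowers the potential.\<close>
  have "(\<Sum>q\<in>insert (r t) (items t). lev t - base (Suc t) q)
      = (\<Sum>q\<in>items t - {r t}. lev t - base t q)"
    using inv(1) by (subst sum.insert_remove) (auto simp: base_Suc)
  also have "\<dots> \<le> (\<Sum>q\<in>items t. lev t - base t q)"
    using inv by (intro sum_mono2) auto
  finally have "(\<Sum>q\<in>insert (r t) (items t). lev t - base (Suc t) q)
      \<le> (\<Sum>q\<in>items t. lev t - base t q)" .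
  moreover have "real (card (insert (r t) (items t))) * (lev (Suc t) - lev t)
      \<le> real k * (lev (Suc t) - lev t)"
    using k[OF t] inv(3) le by (intro mult_right_mono) auto
  moreover have "real k * (lev (Suc t) - lev t) = real k * lev (Suc t) - real k * lev t"
    by (simp add: algebra_simps)
  moreover have "(\<Sum>q\<in>snd (alg_run t). cost q (conf alg_run (Suc t)))
      = (\<Sum>q\<in>insert (r t) (items t) - items (Suc t). cost q (level d (lev (Suc t))))"
    by (simp add: alg_run_eq)
  ultimately show ?case
    using Suc.IH t pay unfolding sum.lessThan_Suc by linarith
qed

lemma alg_cost_le:
  assumes k: "\<And>t. t < n \<Longrightarrow> card (insert (r t) (cache r alg_run t)) \<le> k"
  shows "total_cost d cost n alg_run \<le> real (d + k) * lev n"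
proof -
  have inv: "\<And>q. base n q \<le> lev n" "conf alg_run n = level d (lev n)"
    using state_invariant[of n] by auto
  have "(\<Sum>i<d. conf alg_run n i) = real d * lev n"
    by (simp add: inv(2) level_def)
  moreover have "0 \<le> (\<Sum>q\<in>items n. lev n - base n q)"
    using inv(1) by (intro sum_nonneg) simp
  ultimately show ?thesis
    using alg_evictions_le[OF k order_refl] unfolding total_cost_def
    by (simp add: distrib_right)
qed

section \<open>Lower bound on every offline cost\<close>

lemma conf_le_final:
  assumes S: "valid d cachable r n S" and "t \<le> n"
  shows "conf S t \<le> conf S n"
  using \<open>t \<le> n\<close>
proof (induction rule: inc_induct)
  case (step m)
  then have "conf S m \<le> conf S (Suc m)"
    using S by (simp add: valid_def)
  with step.IH show ?case by (rule order_trans[rotated])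
qed simp

lemma finite_cache: "finite (cache r S t)"
  by (induction t) auto

text \<open>The offline evictions are charged at the final configuration \<open>conf S n\<close>, which is no more than
  what was actually paid for them.\<close>

lemma lev_residual_le:
  assumes S: "valid d cachable r n S" and y: "conf S n \<in> configs d"
  shows "t \<le> n \<Longrightarrow> lev t + residual (cache r S t) (conf S n) (base t) (lev t) (items t)
           \<le> (\<Sum>i<d. conf S n i) + (\<Sum>s<t. \<Sum>q\<in>snd (S s). cost q (conf S n))"
proof (induction t)
  case 0
  have "(\<Sum>i<d. max 0 (conf S n i)) = (\<Sum>i<d. conf S n i)"
    using y by (intro sum.cong) (auto simp: configs_def)
  then show ?case by (simp add: state_0 residual_def)
next
  case (Suc t)
  let ?y = "conf S n" and ?C = "cache r S t" and ?C' = "cache r S (Suc t)" and ?E = "snd (S t)"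
  let ?Q = "insert (r t) (items t)"
  have t: "t < n" using Suc.prems by simp
  have inv: "finite (items t)" "\<And>q. base t q \<le> lev t"
    using state_invariant[of t] t by auto
  have St: "conf S (Suc t) \<in> configs d" "?E \<subseteq> insert (r t) ?C" "cachable t ?C' (conf S (Suc t))"
    using S t by (auto simp: valid_def)
  have finE: "finite ?E"
    using St(2) finite_cache by (rule finite_subset[OF _ finite.insertI])
  \<comment> \<open>Soundness is applied with the single configuration \<open>conf S n\<close> at
    every step, so the offline cache must be cachable there too.\<close>
  have "cachable t ?C' ?y"
    using cachable_pred_mono[OF cachable St(1) y conf_le_final[OF S] order_refl St(3)] t by simp
  then have "lev (Suc t) + residual ?C' ?y (base (Suc t)) (lev (Suc t)) (items (Suc t))
      \<le> lev t + residual ?C' ?y (base (Suc t)) (lev t) ?Q"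
    using sound_step[OF t] y by (simp add: sound_response_def)
  moreover have "residual ?C' ?y (base (Suc t)) (lev t) ?Q
      \<le> residual ?C ?y (base t) (lev t) (items t) + (\<Sum>q\<in>?E. cost q ?y)"
  proof -
    let ?f = "\<lambda>q. max 0 (cost q ?y + base (Suc t) q - lev t)"
    \<comment> \<open>The requested item is in the new offline cache unless it is evicted at once,
      so every new term of the residual comes from \<open>?E\<close>.\<close>
    have "?Q - ?C' \<subseteq> (items t - ?C - {r t}) \<union> ?E" by auto
    then have "(\<Sum>q\<in>?Q - ?C'. ?f q) \<le> (\<Sum>q\<in>(items t - ?C - {r t}) \<union> ?E. ?f q)"
      using inv(1) finE by (intro sum_mono2) auto
    also have "\<dots> \<le> (\<Sum>q\<in>items t - ?C - {r t}. ?f q) + (\<Sum>q\<in>?E. ?f q)"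
      using inv(1) finE by (subst sum.union_inter[symmetric]) (auto intro: sum_nonneg)
    also have "(\<Sum>q\<in>items t - ?C - {r t}. ?f q)
        = (\<Sum>q\<in>items t - ?C - {r t}. max 0 (cost q ?y + base t q - lev t))"
      by (intro sum.cong) (auto simp: base_Suc)
    also have "\<dots> \<le> (\<Sum>q\<in>items t - ?C. max 0 (cost q ?y + base t q - lev t))"
      using inv(1) by (intro sum_mono2) auto
    also have "(\<Sum>q\<in>?E. ?f q) \<le> (\<Sum>q\<in>?E. cost q ?y)"
    proof (rule sum_mono)
      \<comment> \<open>No base exceeds the current level, so a term never exceeds the full eviction
        cost.\<close>
      fix q show "?f q \<le> cost q ?y"
        using inv(2)[of q] cost_nonneg[OF y, of q] by (simp add: base_Suc)
    qed
    finally show ?thesis by (simp add: residual_def)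
  qed
  ultimately show ?case
    using Suc.IH t by simp
qed

lemma lev_le_total_cost:
  assumes S: "valid d cachable r n S"
  shows "lev n \<le> total_cost d cost n S"
proof -
  have y: "conf S n \<in> configs d"
    using S by (cases n) (auto simp: valid_def configs_def)
  have "cost q (conf S n) \<le> cost q (conf S (Suc s))" if "s < n" for q s
    using S that y conf_le_final[OF S, of "Suc s"] by (intro cost_antimono) (auto simp: valid_def)
  then have "(\<Sum>s<n. \<Sum>q\<in>snd (S s). cost q (conf S n))
      \<le> (\<Sum>s<n. \<Sum>q\<in>snd (S s). cost q (conf S (Suc s)))"
    by (intro sum_mono) auto
  then show ?thesis
    using lev_residual_le[OF S y order_refl]
      residual_nonneg[of "cache r S n" "conf S n" "base n" "lev n" "items n"]
    unfolding total_cost_def by linarith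
qed

lemma lev_le_opt_cost: "lev n \<le> opt_cost d cost cachable r n"
  unfolding opt_cost_def using feasible lev_le_total_cost by (intro cInf_greatest) auto

end

theorem theorem5:
  fixes d :: nat and cost :: "'a \<Rightarrow> config \<Rightarrow> real"
  assumes "eviction_cost d cost"
  shows "\<exists>alg :: 'a online_alg. \<forall>cachable k.
           (\<forall>t. cachable_pred d (cachable t)) \<longrightarrow>
           finite (occupancies d cachable) \<longrightarrow> k = Max (occupancies d cachable) \<longrightarrow>
           competitive d cost cachable alg (real (d + k))"
proof -
  interpret upgradable_caching d cost
    by unfold_locales (fact assms)
  show ?thesis
  proof (intro exI[of _ level_alg] allI impI)
    fix cachable :: "nat \<Rightarrow> 'a set \<Rightarrow> config \<Rightarrow> bool" and k
    assume cach: "\<forall>t. cachable_pred d (cachable t)"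
      and fin: "finite (occupancies d cachable)" and k: "k = Max (occupancies d cachable)"
    show "competitive d cost cachable level_alg (real (d + k))"
      unfolding competitive_def
    proof (intro allI impI)
      fix r :: "nat \<Rightarrow> 'a" and n
      assume "\<exists>S. valid d cachable r n S"
      then interpret upgradable_caching_instance d cost cachable r n
        using cach by unfold_locales auto
      \<comment> \<open>Each prefix of the algorithm's own run is a valid strategy, so its
        occupancies are among those bounded by \<open>k\<close>.\<close>
      have "card (insert (r t) (cache r alg_run t)) \<le> k" if "t < n" for t
      proof -
        have "valid d cachable r (Suc t) alg_run"
          using valid_alg_run that unfolding valid_def by simp
        then show ?thesis
          unfolding k using fin by (intro Max_ge) (auto simp: occupancies_def)
      qed
      then have "total_cost d cost n alg_run \<le> real (d + k) * lev n"
        by (rule alg_cost_le)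
      also have "\<dots> \<le> real (d + k) * opt_cost d cost cachable r n"
        by (intro mult_left_mono lev_le_opt_cost) simp
      finally show "valid d cachable r n alg_run \<and>
          total_cost d cost n alg_run \<le> real (d + k) * opt_cost d cost cachable r n"
        using valid_alg_run by simp
    qed
  qed
qed

end
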